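(* Let $\epsilon^*>0$, $\beta=\frac{8}{3}+\epsilon^*$ and $q=\sqrt{\beta n}$. If $n$ is sufficiently large and Breaker plays the $(n,q)$-triangle game according to the strategy described in the context, then at the end of the game no vertex has Maker-degree at least $q/2$, and Breaker wins the game.
   Context: The $(n,q)$-triangle game is played on the complete graph $K_n$ with vertex set $V$, $|V|=n$. In every turn, Maker first claims one previously unclaimed edge and then Breaker claims $q$ previously unclaimed edges; the game ends when all edges are claimed. Maker wins if he claims all three edges of some triangle, otherwise Breaker wins. $\deg_M(v)$ and $\deg_B(v)$ denote the number of edges at $v$ claimed by Maker and by Breaker, respectively; a subscript $t$ (e.g. $\deg_{M,t}(v)$) denotes the value directly after turn $t$, and index $0$ refers to the start of the game. Fix $\delta\in(0,1-\frac{8}{3\beta})$. Let $p_0=\frac{8}{\beta(1-\delta)(3+\delta)}$ and $\mu=1+\frac{6\beta\ln n}{\delta q}$. For $v\in V$ define the balanced Breaker-degree $\deg^*(v)=n-p_0\left(\frac{q^2(1-\delta)(3+\delta)}{8}-\deg_M(v)\left(q-\frac{\deg_M(v)}{2}\right)\right)$, the deficit $d(v)=\deg^*(v)-\deg_B(v)$, and the potential $\mathrm{pot}(v)=0$ if $\deg_M(v)+\deg_B(v)=n-1$, and $\mathrm{pot}(v)=\mu^{d(v)/q}$ otherwise. For an unclaimed edge $e=\{x,y\}$ let $\mathrm{pot}(e)=\mathrm{pot}(x)+\mathrm{pot}(y)$. Breaker's strategy: in a turn $t$ let $\{u,v\}$ be the edge Maker has just claimed. Part 1 (closing edges): Breaker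 claims $\deg_{M,t-1}(v)$ edges incident to $u$ and $\deg_{M,t-1}(u)$ edges incident to $v$, namely the edges closing all newly created Maker paths of length $2$ (for each Maker-neighbour $w$ of $v$ the edge $\{u,w\}$, and for each Maker-neighbour $w$ of $u$ the edge $\{v,w\}$); if such an edge is already claimed, he claims an arbitrary unclaimed edge incident to $u$ (resp. $v$) instead; if no unclaimed edge incident to $u$ (resp. $v$) remains, he claims arbitrary unclaimed edges instead. Part 2 (free edges): with his remaining edges in this turn, Breaker iteratively claims an unclaimed edge $e$ with $\mathrm{pot}(e)\ge\mathrm{pot}(e')$ for all unclaimed edges $e'$ (potentials evaluated in the current position), until he has claimed $q$ edges in this turn. *)

theory Defs
  imports Complex_Main
begin

definition complete_edges :: "'a set \<Rightarrow> 'a set set" where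
  "complete_edges V = {{x, y} | x y. x \<in> V \<and> y \<in> V \<and> x \<noteq> y}"

text \<open>A position is a pair of the set of Maker's edges and the set of Breaker's edges.\<close>

type_synonym 'a position = "'a set set \<times> 'a set set"

definition unclaimed :: "'a set \<Rightarrow> 'a position \<Rightarrow> 'a set set" where
  "unclaimed V P = complete_edges V - (fst P \<union> snd P)"

definition maker_claims :: "'a set \<Rightarrow> 'a position \<Rightarrow> 'a position" where
  "maker_claims e P = (insert e (fst P), snd P)"

definition breaker_claims :: "'a set \<Rightarrow> 'a position \<Rightarrow> 'a position" where
  "breaker_claims e P = (fst P, insert e (snd P))"

definition deg_M :: "'a position \<Rightarrow> 'a \<Rightarrow> nat" where
  "deg_M P v = card {e \<in> fst P. v \<in> e}"

definition deg_B :: "'a position \<Rightarrow> 'a \<Rightarrow> nat" where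
  "deg_B P v = card {e \<in> snd P. v \<in> e}"

definition maker_nbrs :: "'a position \<Rightarrow> 'a \<Rightarrow> 'a set" where
  "maker_nbrs P v = {w. {v, w} \<in> fst P}"

definition maker_has_triangle :: "'a position \<Rightarrow> bool" where
  "maker_has_triangle P \<longleftrightarrow>
     (\<exists>x y z. x \<noteq> y \<and> y \<noteq> z \<and> x \<noteq> z \<and> {x, y} \<in> fst P \<and> {y, z} \<in> fst P \<and> {x, z} \<in> fst P)"

definition game_over :: "'a set \<Rightarrow> 'a position \<Rightarrow> bool" where
  "game_over V P \<longleftrightarrow> unclaimed V P = {}"

definition breaker_wins :: "'a set \<Rightarrow> 'a position \<Rightarrow> bool" where
  "breaker_wins V P \<longleftrightarrow> game_over V P \<and> \<not> maker_has_triangle P"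


definition p0 :: "real \<Rightarrow> real \<Rightarrow> real" where
  "p0 \<beta> \<delta> = 8 / (\<beta> * (1 - \<delta>) * (3 + \<delta>))"

definition mu :: "real \<Rightarrow> real \<Rightarrow> nat \<Rightarrow> nat \<Rightarrow> real" where
  "mu \<beta> \<delta> n q = 1 + 6 * \<beta> * ln (real n) / (\<delta> * real q)"

definition balanced_deg :: "'a set \<Rightarrow> nat \<Rightarrow> real \<Rightarrow> real \<Rightarrow> 'a position \<Rightarrow> 'a \<Rightarrow> real" where
  "balanced_deg V q \<beta> \<delta> P v =
     real (card V) - p0 \<beta> \<delta> *
       ((real q)\<^sup>2 * (1 - \<delta>) * (3 + \<delta>) / 8
        - real (deg_M P v) * (real q - real (deg_M P v) / 2))"

definition deficit :: "'a set \<Rightarrow> nat \<Rightarrow> real \<Rightarrow> real \<Rightarrow> 'a position \<Rightarrow> 'a \<Rightarrow> real" where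
  "deficit V q \<beta> \<delta> P v = balanced_deg V q \<beta> \<delta> P v - real (deg_B P v)"

definition pot :: "'a set \<Rightarrow> nat \<Rightarrow> real \<Rightarrow> real \<Rightarrow> 'a position \<Rightarrow> 'a \<Rightarrow> real" where
  "pot V q \<beta> \<delta> P v =
     (if deg_M P v + deg_B P v = card V - 1 then 0
      else mu \<beta> \<delta> (card V) q powr (deficit V q \<beta> \<delta> P v / real q))"

definition edge_pot :: "'a set \<Rightarrow> nat \<Rightarrow> real \<Rightarrow> real \<Rightarrow> 'a position \<Rightarrow> 'a set \<Rightarrow> real" where
  "edge_pot V q \<beta> \<delta> P e = (\<Sum>x\<in>e. pot V q \<beta> \<delta> P x)"


text \<open>A task \<open>(a, w)\<close> asks Breaker to close the Maker path from \<open>a\<close> to \<open>w\<close> of length two by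
  claiming the edge \<open>{a, w}\<close>, or else a substitute, at \<open>a\<close> if possible.\<close>

definition closing_choices :: "'a set \<Rightarrow> 'a position \<Rightarrow> 'a \<times> 'a \<Rightarrow> 'a set set" where
  "closing_choices V P t =
     (let a = fst t; w = snd t; U = unclaimed V P in
      if {a, w} \<in> U then {{a, w}}
      else if \<exists>e\<in>U. a \<in> e then {e \<in> U. a \<in> e}
      else U)"

definition free_choices ::
    "'a set \<Rightarrow> nat \<Rightarrow> real \<Rightarrow> real \<Rightarrow> 'a position \<Rightarrow> 'a set set" where
  "free_choices V q \<beta> \<delta> P =
     {e \<in> unclaimed V P. \<forall>e'\<in>unclaimed V P. edge_pot V q \<beta> \<delta> P e' \<le> edge_pot V q \<beta> \<delta> P e}"

text \<open>\<open>breaker_turn V q \<beta> \<delta> ts k P P'\<close>: with closing tasks \<open>ts\<close> still to be processed and \<open>k\<close>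
  edges still to be claimed in this turn, Breaker can get from \<open>P\<close> to \<open>P'\<close>. The turn is cut short
  only if no unclaimed edges are left; tasks beyond the \<open>q\<close>-th one, if any, are dropped.\<close>

inductive breaker_turn ::
    "'a set \<Rightarrow> nat \<Rightarrow> real \<Rightarrow> real \<Rightarrow> ('a \<times> 'a) list \<Rightarrow> nat \<Rightarrow> 'a position \<Rightarrow> 'a position \<Rightarrow> bool"
  for V :: "'a set" and q :: nat and \<beta> \<delta> :: real where
  stop: "k = 0 \<or> unclaimed V P = {} \<Longrightarrow> breaker_turn V q \<beta> \<delta> ts k P P"
| closing: "\<lbrakk>e \<in> closing_choices V P t; breaker_turn V q \<beta> \<delta> ts k (breaker_claims e P) P'\<rbrakk>
    \<Longrightarrow> breaker_turn V q \<beta> \<delta> (t # ts) (Suc k) P P'"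
| free: "\<lbrakk>e \<in> free_choices V q \<beta> \<delta> P; breaker_turn V q \<beta> \<delta> [] k (breaker_claims e P) P'\<rbrakk>
    \<Longrightarrow> breaker_turn V q \<beta> \<delta> [] (Suc k) P P'"

text \<open>The positions directly after the turns of a game in which Maker plays arbitrarily and Breaker
  follows the strategy. The closing tasks may be processed in any order.\<close>

inductive reachable :: "'a set \<Rightarrow> nat \<Rightarrow> real \<Rightarrow> real \<Rightarrow> 'a position \<Rightarrow> bool"
  for V :: "'a set" and q :: nat and \<beta> \<delta> :: real where
  start: "reachable V q \<beta> \<delta> ({}, {})"
| turn: "\<lbrakk>reachable V q \<beta> \<delta> P; {u, v} \<in> unclaimed V P; distinct ts;
      set ts = {u} \<times> maker_nbrs P v \<union> {v} \<times> maker_nbrs P u;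
      breaker_turn V q \<beta> \<delta> ts q (maker_claims {u, v} P) P'\<rbrakk>
    \<Longrightarrow> reachable V q \<beta> \<delta> P'"

end

theory Submission
  imports Defs "HOL-Real_Asymp.Real_Asymp"
begin

text \<open>
  Let \<open>S\<close> be the sum of the potentials of all vertices and \<open>M\<close> the largest potential of an unclaimed
  edge. Then \<open>S + ln \<mu> * M\<close> does not increase from turn to turn: if \<open>f\<close> is the number of free edges of
  a turn, Maker's edge and Part 1 multiply the potentials of its two ends by at most
  \<open>\<mu> powr (p\<^sub>0 f / q)\<close>, which costs about \<open>p\<^sub>0 (f / q) (ln \<mu>) M\<close>, while each free edge decreases \<open>S\<close>
  by about \<open>(ln \<mu> / q) M'\<close>, where \<open>M'\<close> is the value of \<open>M\<close> after the turn. Either \<open>M'\<close> is close to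
  \<open>M\<close>, and the free edges win because \<open>p\<^sub>0 < 1\<close>, or the second summand pays for the loss.

  Hence all potentials stay below \<open>n\<^sup>2\<close>, so the deficit of a vertex with an unclaimed edge is at most
  about \<open>\<delta> n / 2\<close>. With Maker-degree close to \<open>q / 2\<close> the balanced degree exceeds \<open>n\<close> by about
  \<open>2 \<delta> n / 3\<close>, so such a vertex has no unclaimed edge. Therefore Maker-degrees stay below \<open>q / 2\<close>, and
  Breaker can always close all new Maker paths.
\<close>

section \<open>Positions, claims and degrees\<close>

definition legal :: "'a set \<Rightarrow> 'a position \<Rightarrow> bool" where
  "legal V P \<longleftrightarrow> fst P \<subseteq> complete_edges V \<and> snd P \<subseteq> complete_edges V \<and> fst P \<inter> snd P = {}"

definition open_vertex :: "'a set \<Rightarrow> 'a position \<Rightarrow> 'a \<Rightarrow> bool" where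
  "open_vertex V P v \<longleftrightarrow> (\<exists>e\<in>unclaimed V P. v \<in> e)"

text \<open>In legal positions this is stronger than the absence of Maker triangles, and in this
  form it can be carried from turn to turn.\<close>

definition paths_closed :: "'a position \<Rightarrow> bool" where
  "paths_closed P \<longleftrightarrow>
     (\<forall>x y z. x \<noteq> z \<longrightarrow> {x, y} \<in> fst P \<longrightarrow> {y, z} \<in> fst P \<longrightarrow> {x, z} \<in> snd P)"

lemma finite_complete_edges: "finite V \<Longrightarrow> finite (complete_edges V)"
  by (rule finite_subset[of _ "Pow V"]) (auto simp: complete_edges_def)

lemma complete_edges_subset: "e \<in> complete_edges V \<Longrightarrow> e \<subseteq> V"
  by (auto simp: complete_edges_def)

lemma pair_in_complete_edges: "{x, y} \<in> complete_edges V \<longleftrightarrow> x \<in> V \<and> y \<in> V \<and> x \<noteq> y"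
  by (auto simp: complete_edges_def doubleton_eq_iff)

lemma unclaimedD: "e \<in> unclaimed V P \<Longrightarrow> e \<in> complete_edges V"
  by (simp add: unclaimed_def)

lemma star_complete_edges: "v \<in> V \<Longrightarrow> {e \<in> complete_edges V. v \<in> e} = (\<lambda>w. {v, w}) ` (V - {v})"
  by (auto simp: complete_edges_def insert_commute)

lemma card_star_complete_edges:
  assumes "v \<in> V"
  shows "card {e \<in> complete_edges V. v \<in> e} = card V - 1"
proof -
  have "inj_on (\<lambda>w. {v, w}) (V - {v})"
    by (auto simp: inj_on_def doubleton_eq_iff)
  thus ?thesis
    using assms by (simp add: star_complete_edges card_image card_Diff_singleton)
qed

lemma deg_sum_eq:
  assumes "finite V" "legal V P"
  shows "deg_M P v + deg_B P v = card {e \<in> fst P \<union> snd P. v \<in> e}"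
proof -
  have fin: "finite (fst P)" "finite (snd P)"
    using assms finite_complete_edges finite_subset unfolding legal_def by blast+
  have "{e \<in> fst P \<union> snd P. v \<in> e} = {e \<in> fst P. v \<in> e} \<union> {e \<in> snd P. v \<in> e}" by auto
  moreover have "{e \<in> fst P. v \<in> e} \<inter> {e \<in> snd P. v \<in> e} = {}"
    using assms by (auto simp: legal_def)
  ultimately show ?thesis
    unfolding deg_M_def deg_B_def using fin by (simp add: card_Un_disjoint)
qed

text \<open>The claimed edges at \<open>v\<close> lie in a star of \<open>card V - 1\<close> edges,
  and a finite subset of full cardinality is the whole star. This turns the zero case of
  \<open>pot\<close> into a statement about unclaimed edges.\<close>

lemma
  assumes "finite V" "legal V P" "v \<in> V"
  shows deg_sum_le: "deg_M P v + deg_B P v \<le> card V - 1"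
    and full_iff_not_open: "deg_M P v + deg_B P v = card V - 1 \<longleftrightarrow> \<not> open_vertex V P v"
proof -
  define C where "C = {e \<in> fst P \<union> snd P. v \<in> e}"
  define S where "S = {e \<in> complete_edges V. v \<in> e}"
  have fin: "finite S" using finite_complete_edges[OF assms(1)] by (simp add: S_def)
  have sub: "C \<subseteq> S" using assms(2) by (auto simp: legal_def C_def S_def)
  have "deg_M P v + deg_B P v = card C" using assms(1,2) unfolding C_def by (rule deg_sum_eq)
  moreover have card_S: "card S = card V - 1" using assms(3) unfolding S_def by (rule card_star_complete_edges)
  moreover have "card C \<le> card S" using fin sub by (rule card_mono)
  ultimately show "deg_M P v + deg_B P v \<le> card V - 1" by simp
  have "C = S" if "card C = card S" using fin sub that by (rule card_subset_eq)
  hence "card C = card S \<longleftrightarrow> C = S" by auto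
  moreover have "C = S \<longleftrightarrow> \<not> open_vertex V P v"
    using sub unfolding open_vertex_def unclaimed_def C_def S_def by blast
  ultimately show "deg_M P v + deg_B P v = card V - 1 \<longleftrightarrow> \<not> open_vertex V P v"
    using \<open>deg_M P v + deg_B P v = card C\<close> card_S by simp
qed

lemma card_maker_nbrs:
  assumes "legal V P"
  shows "card (maker_nbrs P v) = deg_M P v"
proof -
  have "{e \<in> fst P. v \<in> e} = (\<lambda>w. {v, w}) ` maker_nbrs P v"
  proof
    show "{e \<in> fst P. v \<in> e} \<subseteq> (\<lambda>w. {v, w}) ` maker_nbrs P v"
    proof
      fix e assume e: "e \<in> {e \<in> fst P. v \<in> e}"
      then obtain x y where xy: "e = {x, y}"
        using assms by (auto simp: legal_def complete_edges_def)
      show "e \<in> (\<lambda>w. {v, w}) ` maker_nbrs P v"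
        using e xy by (auto simp: maker_nbrs_def insert_commute image_iff)
    qed
  qed (auto simp: maker_nbrs_def)
  moreover have "inj_on (\<lambda>w. {v, w}) (maker_nbrs P v)"
    by (auto simp: inj_on_def doubleton_eq_iff)
  ultimately show ?thesis by (simp add: deg_M_def card_image)
qed

lemma unclaimed_breaker_claims: "unclaimed V (breaker_claims e P) = unclaimed V P - {e}"
  by (auto simp: unclaimed_def breaker_claims_def)

lemma unclaimed_maker_claims: "unclaimed V (maker_claims e P) = unclaimed V P - {e}"
  by (auto simp: unclaimed_def maker_claims_def)

lemma legal_breaker_claims:
  "legal V P \<Longrightarrow> e \<in> unclaimed V P \<Longrightarrow> legal V (breaker_claims e P)"
  by (auto simp: legal_def breaker_claims_def unclaimed_def)

lemma legal_maker_claims: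
  "legal V P \<Longrightarrow> e \<in> unclaimed V P \<Longrightarrow> legal V (maker_claims e P)"
  by (auto simp: legal_def maker_claims_def unclaimed_def)

lemma deg_M_breaker_claims: "deg_M (breaker_claims e P) v = deg_M P v"
  by (simp add: deg_M_def breaker_claims_def)

lemma deg_B_maker_claims: "deg_B (maker_claims e P) v = deg_B P v"
  by (simp add: deg_B_def maker_claims_def)

lemma card_star_insert:
  assumes "finite E" "e \<notin> E"
  shows "card {e' \<in> insert e E. v \<in> e'} = card {e' \<in> E. v \<in> e'} + (if v \<in> e then 1 else 0)"
proof -
  have "{e' \<in> insert e E. v \<in> e'} = (if v \<in> e then insert e {e' \<in> E. v \<in> e'} else {e' \<in> E. v \<in> e'})"
    by auto
  thus ?thesis using assms by simp
qed

lemma deg_B_breaker_claims: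
  assumes "finite V" "legal V P" "e \<in> unclaimed V P"
  shows "deg_B (breaker_claims e P) v = deg_B P v + (if v \<in> e then 1 else 0)"
proof -
  have "finite (snd P)" "e \<notin> snd P"
    using assms finite_complete_edges finite_subset unfolding legal_def unclaimed_def by blast+
  from card_star_insert[OF this] show ?thesis
    by (simp add: deg_B_def breaker_claims_def)
qed

lemma deg_M_maker_claims:
  assumes "finite V" "legal V P" "e \<in> unclaimed V P"
  shows "deg_M (maker_claims e P) v = deg_M P v + (if v \<in> e then 1 else 0)"
proof -
  have "finite (fst P)" "e \<notin> fst P"
    using assms finite_complete_edges finite_subset unfolding legal_def unclaimed_def by blast+
  from card_star_insert[OF this] show ?thesis
    by (simp add: deg_M_def maker_claims_def)
qed

section \<open>Breaker's turns: monotonicity and the closing of paths\<close>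

lemma closing_choices_subset: "closing_choices V P t \<subseteq> unclaimed V P"
  by (auto simp: closing_choices_def Let_def split: if_splits)

lemma closing_choices_incident:
  "e \<in> closing_choices V P t \<Longrightarrow> open_vertex V P (fst t) \<Longrightarrow> fst t \<in> e"
  by (auto simp: closing_choices_def Let_def open_vertex_def split: if_splits)

lemma breaker_turn_mono:
  assumes "breaker_turn V q \<beta> \<delta> ts k P P'" "legal V P"
  shows "legal V P' \<and> fst P' = fst P \<and> snd P \<subseteq> snd P' \<and> unclaimed V P' \<subseteq> unclaimed V P"
  using assms
proof (induction rule: breaker_turn.induct)
  case (closing e P t ts k P')
  hence "e \<in> unclaimed V P" using closing_choices_subset by blast
  with closing show ?case
    by (auto simp: legal_breaker_claims unclaimed_breaker_claims)
      (auto simp: breaker_claims_def)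
next
  case (free e P k P')
  hence "e \<in> unclaimed V P" by (simp add: free_choices_def)
  with free show ?case
    by (auto simp: legal_breaker_claims unclaimed_breaker_claims)
      (auto simp: breaker_claims_def)
qed auto

text \<open>A turn that is cut short leaves nothing unclaimed; otherwise
  \<open>length ts \<le> k\<close> ensures that no task is dropped, and a claimed edge stays
  claimed.\<close>

lemma breaker_turn_closes:
  assumes "breaker_turn V q \<beta> \<delta> ts k P P'" "legal V P" "length ts \<le> k" "(a, w) \<in> set ts"
  shows "{a, w} \<notin> unclaimed V P'"
  using assms
proof (induction rule: breaker_turn.induct)
  case (closing e P t ts k P')
  have e: "e \<in> unclaimed V P" using closing.hyps closing_choices_subset by blast
  have leg: "legal V (breaker_claims e P)" using closing.prems(1) e by (rule legal_breaker_claims)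
  show ?case
  proof (cases "(a, w) = t")
    case True
    hence "{a, w} \<notin> unclaimed V (breaker_claims e P)"
      using closing.hyps(1)
      by (auto simp: unclaimed_breaker_claims closing_choices_def Let_def split: if_splits)
    thus ?thesis using breaker_turn_mono[OF closing.hyps(2) leg] by blast
  next
    case False
    thus ?thesis using closing leg by auto
  qed
qed auto

section \<open>The real inequality behind one turn\<close>

text \<open>\<open>S\<close>, \<open>M\<close> are the total potential and the maximal
  edge potential before the turn, \<open>S'\<close> the total potential after Part 1, and \<open>S''\<close>, \<open>M'\<close> the values
  after the \<open>f\<close> free edges of Part 2.\<close>

lemma turn_inequality:
  fixes S S' S'' M M' L p f q :: real
  assumes L: "0 \<le> L" "4 * L \<le> 1 - p" and p: "0 \<le> p" and q: "1 \<le> q" and f: "0 \<le> f" "f \<le> q"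
    and M: "0 \<le> M" "M' \<le> exp (p * f * (L / q)) * M"
    and S': "S' \<le> S + (exp (p * f * (L / q)) - 1) * M"
    and S'': "S'' + f * (1 - exp (- (L / q))) * M' \<le> S'" and M': "0 \<le> M'"
  shows "S'' + L * M' \<le> S + L * M"
proof -
  define \<theta> where "\<theta> = f * (L / q)"
  have \<theta>: "0 \<le> \<theta>" "\<theta> \<le> L"
  proof -
    show "0 \<le> \<theta>" unfolding \<theta>_def using f q L by simp
    have "f * L \<le> q * L" using f L by (intro mult_right_mono)
    thus "\<theta> \<le> L" unfolding \<theta>_def using q by (simp add: field_simps)
  qed
  have p1: "p \<le> 1" "L \<le> 1" using L p by auto
  have p\<theta>: "p * \<theta> \<le> \<theta>" using p1 \<theta> by (simp add: mult_left_le_one_le p)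
  define E where "E = exp (p * \<theta>)"
  have E: "E \<le> 1 + p * \<theta> + \<theta>\<^sup>2"
  proof -
    have "E \<le> 1 + p * \<theta> + (p * \<theta>)\<^sup>2"
      unfolding E_def using p\<theta> \<theta> p p1 by (intro exp_bound) auto
    moreover have "(p * \<theta>)\<^sup>2 \<le> \<theta>\<^sup>2" using p\<theta> \<theta> p by (intro power_mono) auto
    ultimately show ?thesis by simp
  qed
  have E_eq: "exp (p * f * (L / q)) = E" by (simp add: E_def \<theta>_def mult_ac)
  have drop: "\<theta> * (1 - L) \<le> f * (1 - exp (- (L / q)))"
  proof -
    define y where "y = L / q"
    have y: "0 \<le> y" "y \<le> L" unfolding y_def using L q by (auto simp: field_simps mult_le_cancel_left1)
    \<comment> \<open>This leads to \<open>1 - exp (- y) \<ge> y * (1 - y)\<close>, the effect of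
      one free edge up to second order.\<close>
    have "exp (- y) \<le> 1 / (1 + y)"
      using exp_ge_add_one_self[of y] y by (simp add: exp_minus field_simps)
    also have "\<dots> \<le> 1 - y + y * y"
      using y by (simp add: field_simps)
    finally have "y * (1 - y) \<le> 1 - exp (- y)" by (simp add: algebra_simps)
    moreover have "y * (1 - L) \<le> y * (1 - y)" using y by (intro mult_left_mono) auto
    ultimately have "f * (y * (1 - L)) \<le> f * (1 - exp (- y))" using f by (intro mult_left_mono) auto
    thus ?thesis by (simp add: \<theta>_def y_def mult_ac)
  qed
  \<comment> \<open>The coefficient of \<open>M'\<close> must be nonnegative before
    \<open>M'\<close> is replaced by its upper bound \<open>(1 + x) * M\<close>.\<close>
  have c: "0 \<le> L - \<theta> * (1 - L)"
  proof -
    have "\<theta> * (1 - L) \<le> \<theta> * 1" using \<theta> L by (intro mult_left_mono) auto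
    thus ?thesis using \<theta> by simp
  qed
  define x where "x = p * \<theta> + \<theta>\<^sup>2"
  have x: "0 \<le> x" "x \<le> (p + L) * \<theta>"
    using \<theta> p unfolding x_def by (auto simp: power2_eq_square algebra_simps mult_right_mono)
  have EM: "E * M \<le> (1 + x) * M" using E M(1) by (intro mult_right_mono) (auto simp: x_def)
  have "S'' + L * M' \<le> S' - f * (1 - exp (- (L / q))) * M' + L * M'" using S'' by simp
  also have "\<dots> \<le> S' - \<theta> * (1 - L) * M' + L * M'"
    using mult_right_mono[OF drop M'] by simp
  also have "\<dots> = S' + (L - \<theta> * (1 - L)) * M'" by (simp add: algebra_simps)
  also have "\<dots> \<le> S + x * M + (L - \<theta> * (1 - L)) * ((1 + x) * M)"
  proof (intro add_mono mult_left_mono c)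
    show "S' \<le> S + x * M" using S' EM unfolding E_eq by (simp add: algebra_simps)
    show "M' \<le> (1 + x) * M" using M(2) EM unfolding E_eq by simp
  qed
  also have "\<dots> = S + L * M + (x - \<theta> * (1 - L) + (L - \<theta> * (1 - L)) * x) * M"
    by (simp add: algebra_simps)
  \<comment> \<open>The extra coefficient of \<open>M\<close> is at most
    \<open>\<theta> * (p + 4 * L - 1)\<close>, so \<open>4 * L \<le> 1 - p\<close> suffices.\<close>
  also have "\<dots> \<le> S + L * M"
  proof -
    have "(L - \<theta> * (1 - L)) * x \<le> L * x"
      using x \<theta> p1 by (intro mult_right_mono) auto
    hence "x - \<theta> * (1 - L) + (L - \<theta> * (1 - L)) * x \<le> (1 + L) * x - \<theta> * (1 - L)"
      by (simp add: algebra_simps)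
    also have "\<dots> \<le> (1 + L) * ((p + L) * \<theta>) - \<theta> * (1 - L)"
      using x L by (intro diff_right_mono mult_left_mono) auto
    also have "\<dots> = \<theta> * (p + 2 * L - 1 + L * (p + L))" by (simp add: algebra_simps)
    also have "\<dots> \<le> 0"
    proof -
      have "L * (p + L) \<le> L * 2" using p1 L by (intro mult_left_mono) auto
      thus ?thesis using L \<theta> by (intro mult_nonneg_nonpos) auto
    qed
    finally show ?thesis using M(1) by (simp add: mult_nonpos_nonneg)
  qed
  finally show ?thesis .
qed


section \<open>Potentials of vertices and edges\<close>

text \<open>Collects what the argument takes from \<open>n\<close> being large.
  \<open>ln_mu_small\<close> feeds \<open>turn_inequality\<close>, with \<open>L\<close> the
  logarithm of \<open>mu\<close>; \<open>ln_mu_large\<close> converts potentials up to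
  \<open>n^2\<close> into deficits up to \<open>\<delta> * q^2 / (2 * \<beta>)\<close>;
  \<open>q_ge\<close> makes the initial deficits nonpositive; \<open>q_large\<close> absorbs
  lower-order terms.\<close>

locale breaker_strategy =
  fixes V :: "'a set" and q :: nat and \<beta> \<delta> :: real
  assumes finite_V: "finite V" and card_V: "2 \<le> card V"
    and q_pos: "0 < q" and \<beta>_pos: "0 < \<beta>" and \<delta>: "0 < \<delta>" "\<delta> < 1"
    and p0_less_1: "p0 \<beta> \<delta> < 1"
    and mu_gt_1: "1 < mu \<beta> \<delta> (card V) q"
    and ln_mu_small: "4 * ln (mu \<beta> \<delta> (card V) q) \<le> 1 - p0 \<beta> \<delta>"
    and ln_mu_large: "4 * \<beta> * ln (card V) \<le> \<delta> * q * ln (mu \<beta> \<delta> (card V) q)"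
    and q_ge: "\<beta> * card V \<le> (real q)\<^sup>2"
    and q_large: "real q + 2 < \<delta> * (real q)\<^sup>2 / (6 * \<beta>)"
begin

abbreviation "potential \<equiv> pot V q \<beta> \<delta>"
abbreviation "defect \<equiv> deficit V q \<beta> \<delta>"
abbreviation "epot \<equiv> edge_pot V q \<beta> \<delta>"

text \<open>The potential of an open vertex is \<open>exp (rate * defect P v)\<close>, so a unit of
  deficit is worth a factor \<open>exp rate\<close>. The product \<open>rate * q\<close> is the
  \<open>L\<close> of \<open>turn_inequality\<close>.\<close>

definition rate :: real where "rate = ln (mu \<beta> \<delta> (card V) q) / q"

definition total_pot :: "'a position \<Rightarrow> real" where
  "total_pot P = (\<Sum>v\<in>V. potential P v)"

text \<open>The inserted 0 is the value when no edge is unclaimed.\<close>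

definition max_pot :: "'a position \<Rightarrow> real" where
  "max_pot P = Max (insert 0 (epot P ` unclaimed V P))"

lemma rate_pos: "0 < rate"
  using mu_gt_1 q_pos by (simp add: rate_def)

lemma p0_pos: "0 < p0 \<beta> \<delta>"
  using \<beta>_pos \<delta> by (simp add: p0_def)

lemma potential_eq:
  assumes "legal V P" "v \<in> V"
  shows "potential P v = (if open_vertex V P v then exp (rate * defect P v) else 0)"
  using full_iff_not_open[OF finite_V assms] mu_gt_1
  by (auto simp: pot_def powr_def rate_def mult.commute)

lemma potential_nonneg: "0 \<le> potential P v"
  by (simp add: pot_def)

lemma finite_unclaimed: "finite (unclaimed V P)"
  using finite_complete_edges[OF finite_V] by (simp add: unclaimed_def)

lemma epot_nonneg: "0 \<le> epot P e"
  by (simp add: edge_pot_def sum_nonneg potential_nonneg)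

lemma max_pot_nonneg: "0 \<le> max_pot P"
  unfolding max_pot_def using finite_unclaimed by (intro Max_ge) auto

lemma epot_le_max_pot: "e \<in> unclaimed V P \<Longrightarrow> epot P e \<le> max_pot P"
  unfolding max_pot_def using finite_unclaimed by (intro Max_ge) auto

lemma max_pot_le:
  assumes "0 \<le> c" "\<And>e. e \<in> unclaimed V P \<Longrightarrow> epot P e \<le> c"
  shows "max_pot P \<le> c"
  unfolding max_pot_def using finite_unclaimed assms by (subst Max_le_iff) auto

lemma defect_breaker_claims:
  assumes "legal V P" "e \<in> unclaimed V P"
  shows "defect (breaker_claims e P) v = defect P v - (if v \<in> e then 1 else 0)"
  using assms
  by (simp add: deficit_def balanced_deg_def deg_M_breaker_claims deg_B_breaker_claims[OF finite_V])

text \<open>Only an inequality, since \<open>e\<close> may be the last unclaimed edge at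
  \<open>v\<close>, and then the potential drops to 0.\<close>

lemma potential_breaker_claims:
  assumes "legal V P" "e \<in> unclaimed V P" "v \<in> V"
  shows "potential (breaker_claims e P) v \<le> (if v \<in> e then exp (- rate) else 1) * potential P v"
proof (cases "open_vertex V (breaker_claims e P) v")
  case True
  hence "open_vertex V P v" by (auto simp: open_vertex_def unclaimed_breaker_claims)
  thus ?thesis
    using True assms
    by (simp add: potential_eq legal_breaker_claims defect_breaker_claims algebra_simps
        exp_add[symmetric] exp_diff exp_minus divide_simps)
next
  case False
  thus ?thesis
    using assms by (simp add: potential_eq[OF legal_breaker_claims] potential_nonneg)
qed

lemma potential_breaker_claims_le:
  assumes "legal V P" "e \<in> unclaimed V P" "v \<in> V"
  shows "potential (breaker_claims e P) v \<le> potential P v"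
proof -
  have "exp (- rate) * potential P v \<le> 1 * potential P v"
    using rate_pos potential_nonneg by (intro mult_right_mono) auto
  thus ?thesis using potential_breaker_claims[OF assms] by (auto split: if_splits)
qed

lemma breaker_turn_potential_le:
  assumes "breaker_turn V q \<beta> \<delta> ts k P P'" "legal V P" "v \<in> V"
  shows "potential P' v \<le> potential P v"
  using assms
proof (induction rule: breaker_turn.induct)
  case (closing e P t ts k P')
  hence "e \<in> unclaimed V P" using closing_choices_subset by blast
  with closing show ?case
    using potential_breaker_claims_le[of P e v] legal_breaker_claims[of V P e] by fastforce
next
  case (free e P k P')
  hence "e \<in> unclaimed V P" by (simp add: free_choices_def)
  with free show ?case
    using potential_breaker_claims_le[of P e v] legal_breaker_claims[of V P e] by fastforce
qed auto

text \<open>Applied with \<open>c = 1\<close> to Breaker's claims and with the growth factor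
  \<open>E\<close> to Maker's edge together with Part 1.\<close>

lemma max_pot_mono:
  assumes "unclaimed V P' \<subseteq> unclaimed V P" "1 \<le> c"
    and "\<And>v. v \<in> V \<Longrightarrow> potential P' v \<le> c * potential P v"
  shows "max_pot P' \<le> c * max_pot P"
proof (rule max_pot_le)
  show "0 \<le> c * max_pot P" using assms(2) max_pot_nonneg by simp
  fix e assume e: "e \<in> unclaimed V P'"
  hence eV: "e \<subseteq> V" using unclaimedD complete_edges_subset by blast
  have "epot P' e \<le> (\<Sum>x\<in>e. c * potential P x)"
    unfolding edge_pot_def using eV assms(3) by (intro sum_mono) auto
  also have "\<dots> = c * epot P e" by (simp add: edge_pot_def sum_distrib_left)
  also have "\<dots> \<le> c * max_pot P"
    using e assms(1,2) by (intro mult_left_mono epot_le_max_pot) auto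
  finally show "epot P' e \<le> c * max_pot P" .
qed

lemma breaker_turn_max_pot_le:
  assumes "breaker_turn V q \<beta> \<delta> ts k P P'" "legal V P"
  shows "max_pot P' \<le> max_pot P"
  using max_pot_mono[of P' P 1] breaker_turn_mono[OF assms] breaker_turn_potential_le[OF assms]
  by simp

text \<open>Both ends of \<open>e\<close> lose at least the fraction \<open>1 - exp (- rate)\<close>
  of their potential, and no other vertex gains.\<close>

lemma total_pot_breaker_claims:
  assumes "legal V P" "e \<in> unclaimed V P"
  shows "total_pot (breaker_claims e P) + (1 - exp (- rate)) * epot P e \<le> total_pot P"
proof -
  have eV: "e \<subseteq> V" using assms unclaimedD complete_edges_subset by blast
  have "total_pot (breaker_claims e P)
      \<le> (\<Sum>v\<in>V. potential P v - (if v \<in> e then (1 - exp (- rate)) * potential P v else 0))"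
    unfolding total_pot_def
  proof (rule sum_mono)
    fix v assume "v \<in> V"
    from potential_breaker_claims[OF assms this]
    show "potential (breaker_claims e P) v
        \<le> potential P v - (if v \<in> e then (1 - exp (- rate)) * potential P v else 0)"
      by (auto simp: algebra_simps split: if_splits)
  qed
  also have "\<dots> = total_pot P - (\<Sum>v\<in>V. if v \<in> e then (1 - exp (- rate)) * potential P v else 0)"
    by (simp add: sum_subtractf total_pot_def)
  also have "(\<Sum>v\<in>V. if v \<in> e then (1 - exp (- rate)) * potential P v else 0)
      = (1 - exp (- rate)) * epot P e"
    using eV finite_V
    by (simp add: sum.inter_restrict[symmetric] Int_absorb1 edge_pot_def sum_distrib_left)
  finally show ?thesis by simp
qed

section \<open>Parts 1 and 2 of Breaker's turn\<close>

text \<open>Every free edge has at least the potential of the edges that survive the turn.\<close>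

lemma free_phase:
  assumes "breaker_turn V q \<beta> \<delta> ts k P P'" "ts = []" "legal V P"
  shows "total_pot P' + k * (1 - exp (- rate)) * max_pot P' \<le> total_pot P"
  using assms
proof (induction rule: breaker_turn.induct)
  \<comment> \<open>Either \<open>k = 0\<close>, or nothing is unclaimed and \<open>max_pot\<close>
    is 0, so claims that cannot be made cost nothing.\<close>
  case (stop k P ts)
  thus ?case by (auto simp: max_pot_def)
next
  case (free e P k P')
  have e: "e \<in> unclaimed V P" using free.hyps by (simp add: free_choices_def)
  have leg: "legal V (breaker_claims e P)" using free.prems(2) e by (rule legal_breaker_claims)
  have bt: "breaker_turn V q \<beta> \<delta> [] (Suc k) P P'"
    using free.hyps by (rule breaker_turn.free)
  have "max_pot P' \<le> max_pot P"
    using breaker_turn_max_pot_le[OF bt free.prems(2)] .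
  also have "max_pot P \<le> epot P e"
    using free.hyps(1) epot_nonneg by (intro max_pot_le) (auto simp: free_choices_def)
  finally have "(1 - exp (- rate)) * max_pot P' \<le> (1 - exp (- rate)) * epot P e"
    using rate_pos by (intro mult_left_mono) auto
  moreover have "total_pot P' + k * (1 - exp (- rate)) * max_pot P' \<le> total_pot (breaker_claims e P)"
    using free.IH leg by simp
  ultimately show ?case
    using total_pot_breaker_claims[OF free.prems(2) e] by (simp add: algebra_simps)
qed auto

text \<open>\<open>P1\<close> is the position between Part 1 and Part 2. A task starting at
  \<open>v\<close> is answered by an edge at \<open>v\<close>, even if a substitute is taken, unless
  \<open>v\<close> has no unclaimed edge; then its potential is 0 and the bound is trivial.\<close>

lemma closing_phase:
  assumes "breaker_turn V q \<beta> \<delta> ts k P P'" "legal V P" "length ts \<le> k"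
  shows "\<exists>P1. legal V P1 \<and> unclaimed V P1 \<subseteq> unclaimed V P \<and>
    breaker_turn V q \<beta> \<delta> [] (k - length ts) P1 P' \<and>
    (\<forall>v\<in>V. potential P1 v \<le> exp (- rate * count_list (map fst ts) v) * potential P v)"
  using assms
proof (induction rule: breaker_turn.induct)
  case (stop k P ts)
  have "breaker_turn V q \<beta> \<delta> [] (k - length ts) P P"
    using stop.hyps by (intro breaker_turn.stop) auto
  moreover have "potential P v \<le> exp (- rate * count_list (map fst ts) v) * potential P v"
    if "v \<in> V" for v
  proof (cases "k = 0")
    case True
    thus ?thesis using stop.prems by simp
  next
    case False
    hence "potential P v = 0"
      using stop that potential_eq[of P v] by (simp add: open_vertex_def)
    thus ?thesis by simp
  qed
  ultimately show ?case using stop by blast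
next
  case (closing e P t ts k P')
  have e: "e \<in> unclaimed V P" using closing.hyps closing_choices_subset by blast
  have leg: "legal V (breaker_claims e P)" using closing.prems(1) e by (rule legal_breaker_claims)
  obtain P1 where P1: "legal V P1" "unclaimed V P1 \<subseteq> unclaimed V (breaker_claims e P)"
    "breaker_turn V q \<beta> \<delta> [] (k - length ts) P1 P'"
    "\<And>v. v \<in> V \<Longrightarrow> potential P1 v
      \<le> exp (- rate * count_list (map fst ts) v) * potential (breaker_claims e P) v"
    using closing.IH[OF leg] closing.prems by auto
  have step: "potential (breaker_claims e P) v \<le> exp (- rate * (if fst t = v then 1 else 0)) * potential P v"
    if v: "v \<in> V" for v
  proof (cases "fst t = v")
    case True
    show ?thesis
    proof (cases "open_vertex V P v")
      case is_open: True
      thus ?thesis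
        using closing_choices_incident[OF closing.hyps(1)] True
          potential_breaker_claims[OF closing.prems(1) e v] by auto
    next
      case False
      thus ?thesis
        using potential_breaker_claims_le[OF closing.prems(1) e v] v closing.prems(1)
        by (simp add: potential_eq)
    qed
  next
    case False
    thus ?thesis using potential_breaker_claims_le[OF closing.prems(1) e v] by simp
  qed
  have "potential P1 v \<le> exp (- rate * count_list (map fst (t # ts)) v) * potential P v"
    if v: "v \<in> V" for v
  proof -
    have "potential P1 v \<le> exp (- rate * count_list (map fst ts) v) *
        (exp (- rate * (if fst t = v then 1 else 0)) * potential P v)"
      by (rule order_trans[OF P1(4)[OF v] mult_left_mono[OF step[OF v]]]) simp
    also have "\<dots> = exp (- rate * count_list (map fst (t # ts)) v) * potential P v"
      by (simp add: exp_add[symmetric] algebra_simps)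
    finally show ?thesis .
  qed
  thus ?case using P1 by (intro exI[of _ P1]) (auto simp: unclaimed_breaker_claims)
next
  case (free e P k P')
  have "breaker_turn V q \<beta> \<delta> [] (Suc k) P P'" using free.hyps by (rule breaker_turn.free)
  thus ?case using free.prems by (intro exI[of _ P]) auto
qed

section \<open>The effect of one full turn\<close>

text \<open>The function \<open>m * (q - m / 2)\<close> in the balanced degree grows by
  \<open>q - m - 1 / 2\<close> from \<open>m\<close> to \<open>m + 1\<close>.\<close>

lemma defect_maker_claims:
  assumes "legal V P" "e \<in> unclaimed V P"
  shows "defect (maker_claims e P) v
    = defect P v + (if v \<in> e then p0 \<beta> \<delta> * (real q - deg_M P v - 1 / 2) else 0)"
  using assms
  by (simp add: deficit_def balanced_deg_def deg_B_maker_claims deg_M_maker_claims[OF finite_V])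
    (simp add: field_simps)

lemma potential_maker_claims:
  assumes "legal V P" "e \<in> unclaimed V P" "v \<in> V"
  shows "potential (maker_claims e P) v
    \<le> exp (rate * (if v \<in> e then p0 \<beta> \<delta> * (real q - deg_M P v - 1 / 2) else 0)) * potential P v"
proof (cases "open_vertex V (maker_claims e P) v")
  case True
  hence "open_vertex V P v" by (auto simp: open_vertex_def unclaimed_maker_claims)
  thus ?thesis
    using True assms
    by (simp add: potential_eq legal_maker_claims defect_maker_claims exp_add[symmetric]
        distrib_left add.commute)
next
  case False
  thus ?thesis
    using assms by (simp add: potential_eq[OF legal_maker_claims] potential_nonneg)
qed

text \<open>These are the tasks that charge Part 1 edges to \<open>u\<close>. As
  \<open>u \<noteq> v\<close>, the two blocks of tasks have different first components.\<close>

lemma count_closing_tasks: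
  assumes "legal V P" "distinct ts" "u \<noteq> v"
    "set ts = {u} \<times> maker_nbrs P v \<union> {v} \<times> maker_nbrs P u"
  shows "count_list (map fst ts) u = deg_M P v"
proof -
  have "count_list (map fst ts) u = length (filter (\<lambda>t. u = fst t) ts)"
    by (simp add: count_list_eq_length_filter filter_map comp_def)
  also have "\<dots> = card {t \<in> set ts. u = fst t}"
    using assms(2) by (simp add: distinct_card[symmetric])
  also have "{t \<in> set ts. u = fst t} = {u} \<times> maker_nbrs P v"
    unfolding assms(4) using assms(3) by auto
  also have "card \<dots> = deg_M P v"
    using card_maker_nbrs[OF assms(1)] by (simp add: card_cartesian_product)
  finally show ?thesis .
qed

lemma length_closing_tasks:
  assumes "legal V P" "distinct ts" "{u, v} \<in> unclaimed V P"
    "set ts = {u} \<times> maker_nbrs P v \<union> {v} \<times> maker_nbrs P u"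
  shows "length ts = deg_M P u + deg_M P v"
proof -
  have "u \<noteq> v" using unclaimedD[OF assms(3)] by (simp add: pair_in_complete_edges)
  have "finite (maker_nbrs P x)" if "{x} \<times> maker_nbrs P x' \<union> {x'} \<times> maker_nbrs P x = set ts"
    for x x'
  proof -
    have "finite ({x'} \<times> maker_nbrs P x)"
      by (rule finite_subset[of _ "set ts"]) (use that in auto)
    thus ?thesis by (auto simp: finite_cartesian_product_iff)
  qed
  from this[of u v] this[of v u] have fin: "finite (maker_nbrs P u)" "finite (maker_nbrs P v)"
    using assms(4) by (auto simp: Un_commute)
  have "length ts = card (set ts)" using assms(2) by (simp add: distinct_card)
  also have "\<dots> = card ({u} \<times> maker_nbrs P v) + card ({v} \<times> maker_nbrs P u)"
    unfolding assms(4) using fin \<open>u \<noteq> v\<close> by (intro card_Un_disjoint) auto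
  also have "\<dots> = deg_M P u + deg_M P v"
    using card_maker_nbrs[OF assms(1)] by (simp add: card_cartesian_product)
  finally show ?thesis .
qed

text \<open>An instance of \<open>turn_inequality\<close>, with \<open>S'\<close> taken at the
  position \<open>P1\<close> between the two parts. By \<open>deg\<close> all tasks fit into the
  turn, and the subtraction defining \<open>f\<close> is not truncated.\<close>

lemma turn_potential:
  assumes leg: "legal V P" and uv: "{u, v} \<in> unclaimed V P" and ts: "distinct ts"
    "set ts = {u} \<times> maker_nbrs P v \<union> {v} \<times> maker_nbrs P u"
    and bt: "breaker_turn V q \<beta> \<delta> ts q (maker_claims {u, v} P) P'"
    and deg: "deg_M P u + deg_M P v \<le> q"
  shows "total_pot P' + rate * q * max_pot P' \<le> total_pot P + rate * q * max_pot P"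
proof -
  define Q where "Q = maker_claims {u, v} P"
  define f where "f = q - (deg_M P u + deg_M P v)"
  define E where "E = exp (p0 \<beta> \<delta> * f * rate)"
  have f: "real f = real q - deg_M P u - deg_M P v" using deg by (simp add: f_def)
  have E1: "1 \<le> E" using p0_pos rate_pos by (simp add: E_def)
  have neq: "u \<noteq> v" and uvV: "u \<in> V" "v \<in> V"
    using unclaimedD[OF uv] by (simp_all add: pair_in_complete_edges)
  have legQ: "legal V Q" using leg uv by (simp add: Q_def legal_maker_claims)
  have len: "length ts = deg_M P u + deg_M P v"
    using length_closing_tasks[OF leg ts(1) uv ts(2)] .
  obtain P1 where P1: "legal V P1" "unclaimed V P1 \<subseteq> unclaimed V Q"
    "breaker_turn V q \<beta> \<delta> [] f P1 P'"
    "\<And>x. x \<in> V \<Longrightarrow> potential P1 x \<le> exp (- rate * count_list (map fst ts) x) * potential Q x"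
    using closing_phase[OF bt[folded Q_def] legQ] len deg by (auto simp: f_def)
  have ends: "potential P1 x \<le> E * potential P x"
    if x: "x \<in> {u, v}" and y: "{x, y} = {u, v}" "x \<noteq> y" for x y
  proof -
    have xV: "x \<in> V" using x uvV by auto
    have cnt: "count_list (map fst ts) x = deg_M P y"
      using y ts(2) by (intro count_closing_tasks[OF leg ts(1) y(2)]) (auto simp: doubleton_eq_iff)
    have f': "real f = real q - deg_M P x - deg_M P y"
      using f y by (auto simp: doubleton_eq_iff)
    have "potential P1 x \<le> exp (- rate * deg_M P y) *
        (exp (rate * (p0 \<beta> \<delta> * (real q - deg_M P x - 1 / 2))) * potential P x)"
    proof -
      have "potential Q x \<le> exp (rate * (p0 \<beta> \<delta> * (real q - deg_M P x - 1 / 2))) * potential P x"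
        using potential_maker_claims[OF leg uv xV] x by (simp add: Q_def)
      from order_trans[OF P1(4)[OF xV] mult_left_mono[OF this]] show ?thesis
        unfolding cnt by simp
    qed
    also have "\<dots> = exp (rate * (p0 \<beta> \<delta> * (real q - deg_M P x - 1 / 2) - deg_M P y)) * potential P x"
      by (simp add: exp_add[symmetric] algebra_simps)
    also have "\<dots> \<le> E * potential P x"
    proof -
      \<comment> \<open>As \<open>p0\<close> is below 1, each of the \<open>deg_M P y\<close>
        closing edges at \<open>x\<close> pays for at least \<open>p0\<close>; with the increase
        from Maker's edge, a net growth of at most \<open>p0 * f\<close> remains.\<close>
      have "p0 \<beta> \<delta> * deg_M P y \<le> 1 * real (deg_M P y)"
        using p0_less_1 by (intro mult_right_mono) auto
      hence "p0 \<beta> \<delta> * (real q - deg_M P x - 1 / 2) - deg_M P y \<le> p0 \<beta> \<delta> * f"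
        unfolding f' using p0_pos by (simp add: algebra_simps)
      hence "rate * (p0 \<beta> \<delta> * (real q - deg_M P x - 1 / 2) - deg_M P y) \<le> p0 \<beta> \<delta> * f * rate"
        using rate_pos by (simp add: mult.commute)
      thus ?thesis unfolding E_def using potential_nonneg by (intro mult_right_mono) auto
    qed
    finally show ?thesis .
  qed
  have others: "potential P1 x \<le> potential P x" if x: "x \<in> V" "x \<notin> {u, v}" for x
  proof -
    have "exp (- rate * count_list (map fst ts) x) * potential Q x \<le> 1 * potential Q x"
      using rate_pos potential_nonneg by (intro mult_right_mono) auto
    thus ?thesis
      using P1(4)[OF x(1)] potential_maker_claims[OF leg uv x(1)] x(2) by (simp add: Q_def)
  qed
  \<comment> \<open>Only the two ends can gain, and their potentials add up to that of
    \<open>{u, v}\<close>, which was unclaimed before the turn.\<close>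
  have S: "total_pot P1 \<le> total_pot P + (E - 1) * max_pot P"
  proof -
    have "total_pot P1 \<le> (\<Sum>x\<in>V. potential P x + (if x \<in> {u, v} then (E - 1) * potential P x else 0))"
      unfolding total_pot_def
    proof (rule sum_mono)
      fix x assume "x \<in> V"
      thus "potential P1 x \<le> potential P x + (if x \<in> {u, v} then (E - 1) * potential P x else 0)"
        using ends[of u v] ends[of v u] neq others[of x] by (auto simp: algebra_simps insert_commute)
    qed
    also have "\<dots> = total_pot P + (\<Sum>x\<in>V. if x \<in> {u, v} then (E - 1) * potential P x else 0)"
      by (simp add: sum.distrib total_pot_def)
    also have "(\<Sum>x\<in>V. if x \<in> {u, v} then (E - 1) * potential P x else 0)
        = (\<Sum>x\<in>V \<inter> {u, v}. (E - 1) * potential P x)"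
      using finite_V by (rule sum.inter_restrict[symmetric])
    also have "V \<inter> {u, v} = {u, v}" using uvV by auto
    also have "(\<Sum>x\<in>{u, v}. (E - 1) * potential P x) = (E - 1) * epot P {u, v}"
      by (simp add: edge_pot_def sum_distrib_left)
    also have "\<dots> \<le> (E - 1) * max_pot P"
      using E1 epot_le_max_pot[OF uv] by (intro mult_left_mono) auto
    finally show ?thesis by simp
  qed
  have "max_pot P1 \<le> E * max_pot P"
  proof (rule max_pot_mono)
    show "unclaimed V P1 \<subseteq> unclaimed V P"
      using P1(2) by (auto simp: Q_def unclaimed_maker_claims)
    fix x assume x: "x \<in> V"
    have "1 * potential P x \<le> E * potential P x"
      using E1 potential_nonneg by (intro mult_right_mono) auto
    thus "potential P1 x \<le> E * potential P x"
      using x others[of x] ends[of u v] ends[of v u] neq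
      by (cases "x \<in> {u, v}") (auto simp: insert_commute)
  qed (rule E1)
  hence M: "max_pot P' \<le> E * max_pot P"
    using breaker_turn_max_pot_le[OF P1(3,1)] by simp
  have rq: "rate * q = ln (mu \<beta> \<delta> (card V) q)" using q_pos by (simp add: rate_def)
  have r: "rate * q / q = rate" using q_pos by simp
  show ?thesis
  proof (rule turn_inequality[where p = "p0 \<beta> \<delta>" and q = q and f = f and S' = "total_pot P1"])
    show "max_pot P' \<le> exp (p0 \<beta> \<delta> * f * (rate * q / q)) * max_pot P"
      using M unfolding E_def r .
    show "total_pot P1 \<le> total_pot P + (exp (p0 \<beta> \<delta> * f * (rate * q / q)) - 1) * max_pot P"
      using S unfolding E_def r .
    show "total_pot P' + f * (1 - exp (- (rate * q / q))) * max_pot P' \<le> total_pot P1"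
      using free_phase[OF P1(3) _ P1(1)] unfolding r by simp
  qed (use ln_mu_small rate_pos p0_pos q_pos max_pot_nonneg in \<open>auto simp: rq[symmetric] f_def\<close>)
qed

section \<open>Maker-degrees of open vertices, and the initial potential\<close>

text \<open>An open vertex has potential at most \<open>n^2\<close>, hence deficit at most
  \<open>\<delta> * Q / 2\<close>, but Maker-degree at least \<open>q / 2 - 2\<close> would force a
  larger deficit. The gap of 2 leaves room for Maker's next edge.\<close>

lemma open_vertex_deg_M:
  assumes leg: "legal V P" and v: "v \<in> V" "open_vertex V P v"
    and pot: "total_pot P + rate * q * max_pot P \<le> (card V)\<^sup>2"
    and deg: "deg_M P v < real q / 2"
  shows "deg_M P v < real q / 2 - 2"
proof (rule ccontr)
  assume "\<not> ?thesis"
  hence m: "real q / 2 - 2 \<le> deg_M P v" by simp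
  define m where "m = real (deg_M P v)"
  \<comment> \<open>With Maker-degree 0 the balanced degree is \<open>n - Q\<close>.\<close>
  define Q where "Q = (real q)\<^sup>2 / \<beta>"
  define n where "n = real (card V)"
  have n: "2 \<le> n" using card_V by (simp add: n_def)
  have lnn: "0 < ln n" using n by simp
  have "exp (rate * defect P v) = potential P v" using potential_eq[OF leg v(1)] v(2) by simp
  also have "\<dots> \<le> total_pot P"
    unfolding total_pot_def using finite_V v(1) potential_nonneg by (intro member_le_sum) auto
  also have "\<dots> \<le> total_pot P + rate * q * max_pot P"
    using rate_pos max_pot_nonneg by simp
  also have "\<dots> \<le> n\<^sup>2" using pot by (simp add: n_def)
  also have "n\<^sup>2 = exp (2 * ln n)" using n by (simp add: exp_double)
  finally have rd: "rate * defect P v \<le> 2 * ln n" by simp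
  have "defect P v \<le> \<delta> * Q / 2"
  \<comment> \<open>\<open>ln_mu_large\<close> can be multiplied by the deficit only if the latter
    is nonnegative.\<close>
  proof (cases "0 \<le> defect P v")
    case True
    have "defect P v * (4 * \<beta> * ln n) \<le> defect P v * (\<delta> * q * ln (mu \<beta> \<delta> (card V) q))"
      using ln_mu_large True by (intro mult_left_mono) (auto simp: n_def)
    also have "\<dots> = \<delta> * (real q)\<^sup>2 * (rate * defect P v)"
      using q_pos by (simp add: rate_def power2_eq_square)
    also have "\<dots> \<le> \<delta> * (real q)\<^sup>2 * (2 * ln n)"
      using rd \<delta> by (intro mult_left_mono) auto
    finally have "(defect P v * (4 * \<beta>)) * ln n \<le> (\<delta> * (real q)\<^sup>2 * 2) * ln n"
      by (simp add: mult_ac)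
    hence "defect P v * (4 * \<beta>) \<le> \<delta> * (real q)\<^sup>2 * 2" using lnn by simp
    thus ?thesis using \<beta>_pos by (simp add: Q_def field_simps)
  next
    case False
    moreover have "0 \<le> \<delta> * Q / 2" using \<delta> \<beta>_pos by (simp add: Q_def)
    ultimately show ?thesis by simp
  qed
  moreover have "\<delta> * Q / 2 < defect P v"
  proof -
    define c where "c = (1 - \<delta>) * (3 + \<delta>)"
    have "0 < c" using \<delta> by (simp add: c_def)
    moreover have "c \<le> 3 - 2 * \<delta>" by (simp add: c_def algebra_simps)
    ultimately have c: "0 < c" "c \<le> 3 - 2 * \<delta>" .
    have p0c: "p0 \<beta> \<delta> = 8 / (\<beta> * c)" by (simp add: p0_def c_def)
    have "3 * (real q)\<^sup>2 / 8 - q - 2 \<le> m * (q - m / 2)"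
    proof -
      \<comment> \<open>This product is the difference of the values of
        \<open>m * (q - m / 2)\<close> at \<open>m\<close> and at \<open>q / 2 - 2\<close>; the
        latter value is \<open>3 * q^2 / 8 - q - 2\<close>.\<close>
      have "0 \<le> (m - (real q / 2 - 2)) * (q - (m + (real q / 2 - 2)) / 2)"
        using m deg by (intro mult_nonneg_nonneg) (auto simp: m_def)
      thus ?thesis by (simp add: power2_eq_square field_simps)
    qed
    hence "p0 \<beta> \<delta> * (3 * (real q)\<^sup>2 / 8 - q - 2) \<le> p0 \<beta> \<delta> * (m * (q - m / 2))"
      using p0_pos by (intro mult_left_mono) auto
    moreover have "p0 \<beta> \<delta> * (3 * (real q)\<^sup>2 / 8 - q - 2) = 3 / c * Q - p0 \<beta> \<delta> * (q + 2)"
      using c \<beta>_pos by (simp add: p0c Q_def field_simps)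
    moreover have "p0 \<beta> \<delta> * (q + 2) \<le> q + 2"
      using p0_less_1 p0_pos by (simp add: mult_left_le_one_le)
    \<comment> \<open>Holds because \<open>(1 + 2 * \<delta> / 3) * (3 - 2 * \<delta>) = 3 - 4 *
      \<delta>^2 / 3\<close>.\<close>
    moreover have "(1 + 2 * \<delta> / 3) * Q \<le> 3 / c * Q"
    proof (rule mult_right_mono)
      have "(1 + 2 * \<delta> / 3) * c \<le> (1 + 2 * \<delta> / 3) * (3 - 2 * \<delta>)"
        using c \<delta> by (intro mult_left_mono) auto
      also have "\<dots> \<le> 3" using \<delta> by (simp add: algebra_simps)
      finally show "1 + 2 * \<delta> / 3 \<le> 3 / c" using c by (simp add: field_simps)
    qed (use \<beta>_pos in \<open>simp add: Q_def\<close>)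
    ultimately have "(1 + 2 * \<delta> / 3) * Q - (q + 2) \<le> p0 \<beta> \<delta> * (m * (q - m / 2))" by linarith
    moreover have "defect P v = n - Q + p0 \<beta> \<delta> * (m * (q - m / 2)) - deg_B P v"
    proof -
      have "p0 \<beta> \<delta> * ((real q)\<^sup>2 * (1 - \<delta>) * (3 + \<delta>) / 8) = Q"
        using c \<beta>_pos by (simp add: p0c Q_def c_def[symmetric] mult.assoc)
      thus ?thesis
        by (simp add: deficit_def balanced_deg_def n_def m_def right_diff_distrib)
    qed
    moreover have "deg_B P v \<le> n"
      using deg_sum_le[OF finite_V leg v(1)] by (simp add: n_def)
    \<comment> \<open>The margin is \<open>2 / 3 - 1 / 2 = 1 / 6\<close> of
      \<open>\<delta> * Q\<close>.\<close>
    moreover have "q + 2 < \<delta> * Q / 6" using q_large by (simp add: Q_def mult_ac)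
    ultimately show ?thesis by (simp add: algebra_simps)
  qed
  ultimately show False by simp
qed

text \<open>Before the first claim every deficit is \<open>n - q^2 / \<beta>\<close>, at most 0 by
  \<open>q_ge\<close>. So potentials are at most 1, and the sum is at most
  \<open>n + 2 \<le> n^2\<close>.\<close>

lemma start_potential: "total_pot ({}, {}) + rate * q * max_pot ({}, {}) \<le> (card V)\<^sup>2"
proof -
  have leg: "legal V ({}, {})" by (simp add: legal_def)
  have d: "defect ({}, {}) v \<le> 0" for v
  proof -
    have "p0 \<beta> \<delta> * ((real q)\<^sup>2 * (1 - \<delta>) * (3 + \<delta>) / 8) = (real q)\<^sup>2 / \<beta>"
      using \<delta> \<beta>_pos by (simp add: p0_def)
    moreover have "card V \<le> (real q)\<^sup>2 / \<beta>" using q_ge \<beta>_pos by (simp add: field_simps)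
    ultimately show ?thesis by (simp add: deficit_def balanced_deg_def deg_M_def deg_B_def)
  qed
  have pot1: "potential ({}, {}) v \<le> 1" if "v \<in> V" for v
    using potential_eq[OF leg that] d[of v] rate_pos by (auto simp: mult_le_0_iff)
  have "total_pot ({}, {}) \<le> (\<Sum>v\<in>V. 1)"
    unfolding total_pot_def using pot1 by (rule sum_mono)
  hence S: "total_pot ({}, {}) \<le> card V" by simp
  have M: "max_pot ({}, {}) \<le> 2"
  proof (rule max_pot_le)
    fix e assume "e \<in> unclaimed V ({}, {})"
    then obtain x y where e: "e = {x, y}" "x \<in> V" "y \<in> V" "x \<noteq> y"
      by (auto simp: unclaimed_def complete_edges_def)
    thus "epot ({}, {}) e \<le> 2" using pot1[of x] pot1[of y] by (simp add: edge_pot_def)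
  qed simp
  have "rate * q \<le> 1" using ln_mu_small p0_pos q_pos by (simp add: rate_def)
  hence "rate * q * max_pot ({}, {}) \<le> 1 * 2"
    using M max_pot_nonneg rate_pos by (intro mult_mono) auto
  moreover have "real (card V) + 2 \<le> (real (card V))\<^sup>2"
  proof -
    have "0 \<le> (real (card V) - 2) * (real (card V) + 1)" using card_V by simp
    thus ?thesis by (simp add: power2_eq_square algebra_simps)
  qed
  ultimately show ?thesis using S by simp
qed

end

section \<open>Closed Maker paths\<close>

text \<open>A new Maker path of length two consists of \<open>{u, v}\<close> and an old Maker edge
  at one of its ends; the tasks name the edges closing such paths.\<close>

lemma paths_closed_turn:
  assumes leg: "legal V P" and pc: "paths_closed P" and uv: "{u, v} \<in> unclaimed V P"
    and leg': "legal V P'" and M: "fst P' = insert {u, v} (fst P)" and B: "snd P \<subseteq> snd P'"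
    and tasks: "\<And>a w. (a, w) \<in> {u} \<times> maker_nbrs P v \<union> {v} \<times> maker_nbrs P u \<Longrightarrow>
      {a, w} \<notin> unclaimed V P'"
  shows "paths_closed P'"
proof -
  have neq: "u \<noteq> v" and uvV: "u \<in> V" "v \<in> V"
    using unclaimedD[OF uv] by (simp_all add: pair_in_complete_edges)
  have new: "{a, w} \<in> snd P'" if ab: "{a, b} = {u, v}" and w: "w \<noteq> a" "{b, w} \<in> fst P" for a b w
  proof -
    have "{b, w} \<in> complete_edges V" using w leg by (auto simp: legal_def)
    hence aw: "{a, w} \<in> complete_edges V"
      using w ab uvV by (auto simp: pair_in_complete_edges doubleton_eq_iff)
    \<comment> \<open>Otherwise \<open>a\<close>, \<open>w\<close>, \<open>b\<close> would be an old
      Maker path, and Breaker would own \<open>{a, b} = {u, v}\<close>, which is unclaimed in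
      \<open>P\<close>.\<close>
    have "{a, w} \<notin> fst P"
    proof
      assume "{a, w} \<in> fst P"
      moreover have "{w, b} \<in> fst P" using w(2) by (simp only: insert_commute)
      moreover have "a \<noteq> b" using ab neq by (auto simp: doubleton_eq_iff)
      ultimately have "{a, b} \<in> snd P" using pc unfolding paths_closed_def by blast
      thus False using uv ab by (simp add: unclaimed_def)
    qed
    moreover have "{a, w} \<noteq> {u, v}"
    proof
      assume "{a, w} = {u, v}"
      hence "w = b" using ab w(1) by (auto simp: doubleton_eq_iff)
      thus False using w(2) leg by (auto simp: legal_def complete_edges_def)
    qed
    ultimately have "{a, w} \<notin> fst P'" using M by simp
    moreover have "{a, w} \<notin> unclaimed V P'"
      using ab w by (intro tasks) (auto simp: doubleton_eq_iff maker_nbrs_def)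
    ultimately show ?thesis using aw by (simp add: unclaimed_def)
  qed
  show ?thesis unfolding paths_closed_def
  proof (intro allI impI)
    fix x y z assume xz: "x \<noteq> z" and xy: "{x, y} \<in> fst P'" and yz: "{y, z} \<in> fst P'"
    consider "{x, y} \<in> fst P" "{y, z} \<in> fst P" | "{x, y} = {u, v}" "{y, z} \<in> fst P"
      | "{x, y} \<in> fst P" "{y, z} = {u, v}" | "{x, y} = {u, v}" "{y, z} = {u, v}"
      using xy yz M by auto
    thus "{x, z} \<in> snd P'"
    proof cases
      case 1
      thus ?thesis using pc xz B unfolding paths_closed_def by blast
    next
      case 2
      thus ?thesis using new[of x y z] xz by auto
    next
      case 3
      hence "{z, x} \<in> snd P'" using xz by (intro new[of z y x]) (simp_all add: insert_commute)
      thus ?thesis by (simp only: insert_commute)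
    next
      case 4
      thus ?thesis using xz by (auto simp: doubleton_eq_iff)
    qed
  qed
qed

lemma paths_closed_no_triangle:
  assumes "legal V P" "paths_closed P"
  shows "\<not> maker_has_triangle P"
proof
  assume "maker_has_triangle P"
  then obtain x y z where "x \<noteq> z" "{x, y} \<in> fst P" "{y, z} \<in> fst P" "{x, z} \<in> fst P"
    unfolding maker_has_triangle_def by blast
  thus False using assms unfolding paths_closed_def legal_def by blast
qed

section \<open>The invariant of the game\<close>

context breaker_strategy
begin

text \<open>The conjuncts support each other: the potential bound limits the Maker-degrees of open
  vertices, so all tasks fit into \<open>q\<close> claims, and this keeps paths closed and preserves
  the potential bound.\<close>

lemma reachable_invariant:
  assumes "reachable V q \<beta> \<delta> P"
  shows "legal V P \<and> paths_closed P \<and> (\<forall>v\<in>V. deg_M P v < real q / 2) \<and>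
    total_pot P + rate * q * max_pot P \<le> (card V)\<^sup>2"
  using assms
proof (induction rule: reachable.induct)
  case start
  show ?case using start_potential q_pos by (simp add: legal_def paths_closed_def deg_M_def)
next
  case (turn P u v ts P')
  have leg: "legal V P" and pc: "paths_closed P" and pot: "total_pot P + rate * q * max_pot P \<le> (card V)\<^sup>2"
    and deg: "\<And>v. v \<in> V \<Longrightarrow> deg_M P v < real q / 2" using turn.IH by auto
  note uv = turn.hyps(2) and ts = turn.hyps(3,4) and bt = turn.hyps(5)
  have uvV: "u \<in> V" "v \<in> V" using unclaimedD[OF uv] by (simp_all add: pair_in_complete_edges)
  have legQ: "legal V (maker_claims {u, v} P)" using leg uv by (rule legal_maker_claims)
  have mono: "legal V P'" "fst P' = insert {u, v} (fst P)" "snd P \<subseteq> snd P'"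
    using breaker_turn_mono[OF bt legQ] by (auto simp: maker_claims_def)
  \<comment> \<open>Both ends of Maker's edge are open before the turn, and no other vertex changes
    its Maker-degree.\<close>
  have small: "deg_M P x < real q / 2 - 2" if "x \<in> {u, v}" for x
  proof (rule open_vertex_deg_M[OF leg _ _ pot])
    show "x \<in> V" using that uvV by auto
    thus "deg_M P x < real q / 2" by (rule deg)
    show "open_vertex V P x" using that uv by (auto simp: open_vertex_def)
  qed
  have degs: "deg_M P u + deg_M P v \<le> q" using small[of u] small[of v] by simp
  have "paths_closed P'"
  proof (rule paths_closed_turn[OF leg pc uv mono])
    fix a w assume "(a, w) \<in> {u} \<times> maker_nbrs P v \<union> {v} \<times> maker_nbrs P u"
    thus "{a, w} \<notin> unclaimed V P'"
      using length_closing_tasks[OF leg ts(1) uv ts(2)] degs ts(2)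
      by (intro breaker_turn_closes[OF bt legQ]) auto
  qed
  moreover have "deg_M P' x < real q / 2" if "x \<in> V" for x
  proof -
    have "deg_M P' x = deg_M (maker_claims {u, v} P) x"
      using mono(2) by (simp add: deg_M_def maker_claims_def)
    also have "\<dots> = deg_M P x + (if x \<in> {u, v} then 1 else 0)"
      by (rule deg_M_maker_claims[OF finite_V leg uv])
    finally show ?thesis using small[of x] deg[OF that] by (auto split: if_splits)
  qed
  ultimately show ?case
    using mono(1) turn_potential[OF leg uv ts bt degs] pot by auto
qed

lemma breaker_strategy_wins:
  assumes "reachable V q \<beta> \<delta> P" "game_over V P"
  shows "\<not> (\<exists>v\<in>V. real (deg_M P v) \<ge> real q / 2) \<and> breaker_wins V P"
  using reachable_invariant[OF assms(1)] paths_closed_no_triangle[of V P] assms(2)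
  by (auto simp: breaker_wins_def not_le)

end

section \<open>The parameters for large \<open>n\<close>\<close>

lemma eventually_breaker_strategy:
  fixes \<beta> \<delta> :: real
  assumes \<beta>: "0 < \<beta>" and \<delta>: "0 < \<delta>" "\<delta> < 1 - 8 / (3 * \<beta>)"
  shows "\<forall>\<^sub>F n in sequentially. \<forall>V :: 'a set. finite V \<and> card V = n \<longrightarrow>
    breaker_strategy V (nat \<lceil>sqrt (\<beta> * real n)\<rceil>) \<beta> \<delta>"
proof -
  have \<delta>1: "\<delta> < 1" using \<delta> \<beta> by (smt (verit) divide_pos_pos)
  have p: "p0 \<beta> \<delta> < 1"
  proof -
    \<comment> \<open>This restates the upper bound on \<open>\<delta>\<close>; multiplying by
      \<open>3 + \<delta> \<ge> 3\<close> gives a denominator above 8.\<close>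
    have "8 / 3 < \<beta> * (1 - \<delta>)" using \<delta> \<beta> by (simp add: field_simps)
    moreover have "\<beta> * (1 - \<delta>) * 3 \<le> \<beta> * (1 - \<delta>) * (3 + \<delta>)"
      using \<beta> \<delta> \<delta>1 by (intro mult_left_mono) auto
    ultimately have "8 < \<beta> * (1 - \<delta>) * (3 + \<delta>)" by linarith
    thus ?thesis by (simp add: p0_def)
  qed
  \<comment> \<open>The bound \<open>1 / 2\<close> serves the lower estimate of
    \<open>ln (1 + x)\<close>, and the other term yields \<open>ln_mu_small\<close>.\<close>
  define c where "c = min (1 / 2) ((1 - p0 \<beta> \<delta>) / 4)"
  have c: "0 < c" using p by (simp add: c_def)
  have "\<forall>\<^sub>F n in sequentially. 6 * \<beta> * ln (real n) / (\<delta> * sqrt (\<beta> * real n)) < c"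
  proof (rule order_tendstoD(2)[OF _ c])
    show "(\<lambda>n. 6 * \<beta> * ln (real n) / (\<delta> * sqrt (\<beta> * real n))) \<longlonglongrightarrow> 0"
      using \<beta> \<delta> by real_asymp
  qed
  \<comment> \<open>The term \<open>18 * \<beta> / \<delta>\<close> gives
    \<open>3 * q < \<delta> * q^2 / (6 * \<beta>)\<close>, and \<open>2 < q\<close> gives
    \<open>q + 2 < 3 * q\<close>.\<close>
  moreover have "\<forall>\<^sub>F n in sequentially. max 2 (18 * \<beta> / \<delta>) < sqrt (\<beta> * real n)"
  proof -
    have "filterlim (\<lambda>n. sqrt (\<beta> * real n)) at_top sequentially" using \<beta> by real_asymp
    thus ?thesis unfolding filterlim_at_top_dense by blast
  qed
  ultimately show ?thesis using eventually_ge_at_top[of 2]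
  proof eventually_elim
    case (elim n)
    define s where "s = sqrt (\<beta> * real n)"
    define q where "q = nat \<lceil>s\<rceil>"
    define x where "x = 6 * \<beta> * ln (real n) / (\<delta> * q)"
    have s: "2 < s" "18 * \<beta> / \<delta> < s" using elim(2) by (auto simp: s_def)
    have q: "s \<le> q" using s by (simp add: q_def of_nat_ceiling)
    hence q2: "2 < real q" "18 * \<beta> / \<delta> < real q" using s by auto
    have lnn: "0 < ln (real n)" using elim(3) by simp
    have "x \<le> 6 * \<beta> * ln (real n) / (\<delta> * s)"
      unfolding x_def using q s \<beta> \<delta> lnn by (intro divide_left_mono mult_left_mono) auto
    hence xc: "x < c" using elim(1) by (simp add: s_def)
    have x: "0 < x" unfolding x_def using \<beta> \<delta> lnn q2 by simp
    have mu: "mu \<beta> \<delta> n q = 1 + x" by (simp add: mu_def x_def)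
    have ln_le: "ln (1 + x) \<le> x" using x by (intro ln_add_one_self_le_self) auto
    \<comment> \<open>Combines \<open>ln y \<le> y - 1\<close> at \<open>y = 1 / (1 + x)\<close>
      with \<open>x < 1 / 2\<close>. The factor \<open>2 / 3\<close> turns the 6 in
      \<open>mu\<close> into the 4 of \<open>ln_mu_large\<close>.\<close>
    have ln_ge: "2 / 3 * x \<le> ln (1 + x)"
    proof -
      have "2 / 3 * x \<le> x / (1 + x)"
        using x xc by (simp add: c_def field_simps)
      also have "\<dots> = 1 - inverse (1 + x)" using x by (simp add: field_simps)
      also have "\<dots> \<le> ln (1 + x)" using ln_le_minus_one[of "inverse (1 + x)"] x by (simp add: ln_inverse)
      finally show ?thesis .
    qed
    show ?case
    proof (intro allI impI, elim conjE)
      fix V :: "'a set" assume V: "finite V" "card V = n"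
      have "breaker_strategy V q \<beta> \<delta>"
      proof
        show "4 * \<beta> * ln (card V) \<le> \<delta> * q * ln (mu \<beta> \<delta> (card V) q)"
        proof -
          have "4 * \<beta> * ln (real n) = \<delta> * q * (2 / 3 * x)"
            using \<delta> q2 by (simp add: x_def)
          also have "\<dots> \<le> \<delta> * q * ln (1 + x)"
            using ln_ge \<delta> by (intro mult_left_mono) auto
          finally show ?thesis by (simp add: V mu)
        qed
        show "\<beta> * card V \<le> (real q)\<^sup>2"
        proof -
          have "\<beta> * n = s\<^sup>2" using \<beta> by (simp add: s_def)
          also have "\<dots> \<le> (real q)\<^sup>2" using q s by (intro power_mono) auto
          finally show ?thesis by (simp add: V)
        qed
        show "real q + 2 < \<delta> * (real q)\<^sup>2 / (6 * \<beta>)"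
        proof -
          have "3 < \<delta> * q / (6 * \<beta>)" using q2 \<beta> \<delta> by (simp add: field_simps)
          hence "3 * real q < \<delta> * q / (6 * \<beta>) * q" using q2 by (intro mult_strict_right_mono) auto
          thus ?thesis using q2 by (simp add: power2_eq_square)
        qed
        show "4 * ln (mu \<beta> \<delta> (card V) q) \<le> 1 - p0 \<beta> \<delta>"
          using ln_le xc by (simp add: V mu c_def)
      qed (use V elim(3) q2 \<beta> \<delta> \<delta>1 p x mu in auto)
      thus "breaker_strategy V (nat \<lceil>sqrt (\<beta> * real n)\<rceil>) \<beta> \<delta>" by (simp add: q_def s_def)
    qed
  qed
qed

theorem theorem2p10:
  fixes \<epsilon> \<beta> \<delta> :: real
  assumes "\<epsilon> > 0"
    and "\<beta> = 8 / 3 + \<epsilon>"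
    and "0 < \<delta>" and "\<delta> < 1 - 8 / (3 * \<beta>)"
  shows "\<exists>N. \<forall>n\<ge>N. \<forall>(V :: 'a set) q P.
           finite V \<and> card V = n \<and> q = nat \<lceil>sqrt (\<beta> * real n)\<rceil> \<and>
           reachable V q \<beta> \<delta> P \<and> game_over V P \<longrightarrow>
             \<not> (\<exists>v\<in>V. real (deg_M P v) \<ge> real q / 2) \<and> breaker_wins V P"
proof -
  have "0 < \<beta>" using assms by simp
  from eventually_breaker_strategy[OF this assms(3,4)]
  obtain N where N: "\<And>n V. N \<le> n \<Longrightarrow> finite (V :: 'a set) \<Longrightarrow> card V = n \<Longrightarrow>
      breaker_strategy V (nat \<lceil>sqrt (\<beta> * real n)\<rceil>) \<beta> \<delta>"
    unfolding eventually_sequentially by blast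
  show ?thesis
  proof (intro exI[of _ N] allI impI, elim conjE)
    fix n q :: nat and V :: "'a set" and P
    assume "N \<le> n" "finite V" "card V = n" and q: "q = nat \<lceil>sqrt (\<beta> * real n)\<rceil>"
      and P: "reachable V q \<beta> \<delta> P" "game_over V P"
    hence "breaker_strategy V q \<beta> \<delta>" using N by simp
    from breaker_strategy.breaker_strategy_wins[OF this P]
    show "\<not> (\<exists>v\<in>V. real (deg_M P v) \<ge> real q / 2) \<and> breaker_wins V P" .
  qed
qed

end
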